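(* Let $(D,\epsilon)\in\mathcal R$, and consider the off-line policy $u_t=1$ for $t\le t_s$, $u_t=0$ for $t>t_s$. This policy is $(D,\epsilon)$-feasible if $$t_s\ \ge\ t_s^*=\frac{R_0}{R_1-R_0}\left[\frac1{\alpha_0}\log\left(\frac{1}{\epsilon-e^{-\alpha_1 D}}\right)-D\right].$$
   Context: Media streaming model with infinite file size. Let $R_0>1$, $R_c>0$, $R_1=R_0+R_c$. Let $N_t$ and $N^c_t$ be independent Poisson processes of rates $R_0$ (free server) and $R_c$ (costly server). With initial buffer size $D$ and actions $u_t\in\{0,1\}$ ($u_t=1$ if both servers are used at time $t$, $u_t=0$ if only the free one is used), the buffer size is $$x_t = D+N_t+\int_0^t u_\tau\, dN^c_\tau - t .$$ The interruption probability of a policy $\pi$ is $p^\pi(D)=\mathbf P\{\exists\, t\ge 0:\ x_t\le 0\}$. The policy is $(D,\epsilon)$-feasible if $p^\pi(D)\le\epsilon$. For $R>1$ let $\bar r(R)=\sup\{r:\ r+R(e^{-r}-1)=0\}$, and put $\alpha_0=\bar r(R_0)$, $\alpha_1=\bar r(R_1)$. Let $$\mathcal R=\Big\{(D,\epsilon):\ \epsilon\in(0,1),\ \tfrac1{\alpha_1}\log\tfrac1\epsilon\le D\le\tfrac1{\alpha_0}\log\tfrac1\epsilon\Big\}.$$ Convention: $\log(1/0)=+\infty$, so that $t_s^*=+\infty$ when $\epsilon=e^{-\alpha_1D}$. *)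

theory Defs
  imports "HOL-Probability.Probability"
begin

text \<open>Times are nonnegative reals: a process is a function of type
  \<^typ>\<open>real \<Rightarrow> 'a \<Rightarrow> nat\<close>, of which only the values at times \<open>t \<ge> 0\<close> matter.
  The path conditions are imposed on every sample path, as is usual for a counting process.\<close>

locale poisson_process = prob_space M for M :: "'a measure" +
  fixes rate :: real and N :: "real \<Rightarrow> 'a \<Rightarrow> nat"
  assumes rate_pos: "0 < rate"
    and measurable_process: "\<And>t. 0 \<le> t \<Longrightarrow> N t \<in> M \<rightarrow>\<^sub>M count_space UNIV"
    and starts_at_zero: "\<And>\<omega>. \<omega> \<in> space M \<Longrightarrow> N 0 \<omega> = 0"
    and mono_paths: "\<And>\<omega>. \<omega> \<in> space M \<Longrightarrow> mono_on {0..} (\<lambda>t. N t \<omega>)"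
    and right_continuous_paths:
      "\<And>\<omega> t. \<omega> \<in> space M \<Longrightarrow> 0 \<le> t \<Longrightarrow> continuous (at_right t) (\<lambda>s. real (N s \<omega>))"
    and poisson_increments:
      "\<And>s t. 0 \<le> s \<Longrightarrow> s < t \<Longrightarrow>
        distr M (count_space UNIV) (\<lambda>\<omega>. N t \<omega> - N s \<omega>) = measure_pmf (poisson_pmf (rate * (t - s)))"
    and independent_increments:
      "\<And>(\<tau> :: nat \<Rightarrow> real) n. 0 \<le> \<tau> 0 \<Longrightarrow> (\<And>i. i < n \<Longrightarrow> \<tau> i \<le> \<tau> (Suc i)) \<Longrightarrow>
        indep_vars (\<lambda>_. count_space UNIV) (\<lambda>i \<omega>. N (\<tau> (Suc i)) \<omega> - N (\<tau> i) \<omega>) {..<n}"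

text \<open>Independence of the two processes as random functions of time, not merely at each
  single time.\<close>

definition independent_processes ::
    "'a measure \<Rightarrow> (real \<Rightarrow> 'a \<Rightarrow> nat) \<Rightarrow> (real \<Rightarrow> 'a \<Rightarrow> nat) \<Rightarrow> bool" where
  "independent_processes M X Y \<longleftrightarrow>
     prob_space.indep_var M
       (PiM {0..} (\<lambda>_. count_space UNIV)) (\<lambda>\<omega>. \<lambda>t\<in>{0..}. X t \<omega>)
       (PiM {0..} (\<lambda>_. count_space UNIV)) (\<lambda>\<omega>. \<lambda>t\<in>{0..}. Y t \<omega>)"

text \<open>The pathwise Lebesgue-Stieltjes integral of \<open>u\<close> with respect to the path \<open>g\<close> over
  \<open>(0, t]\<close>. The constant extension of \<open>g\<close> to negative times is only there because
  \<^const>\<open>interval_measure\<close> expects a function on the whole line.\<close>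

definition stieltjes_integral :: "(real \<Rightarrow> real) \<Rightarrow> (real \<Rightarrow> nat) \<Rightarrow> real \<Rightarrow> real" where
  "stieltjes_integral u g t = (LINT \<tau>:{0<..t}|interval_measure (\<lambda>s. real (g (max 0 s))). u \<tau>)"

text \<open>\<open>u \<tau> \<omega>\<close> is the action, \<open>0\<close> or \<open>1\<close>, that the policy takes at time \<open>\<tau>\<close>.\<close>

definition buffer ::
    "(real \<Rightarrow> 'a \<Rightarrow> nat) \<Rightarrow> (real \<Rightarrow> 'a \<Rightarrow> nat) \<Rightarrow> (real \<Rightarrow> 'a \<Rightarrow> real) \<Rightarrow> real \<Rightarrow> real \<Rightarrow> 'a \<Rightarrow> real" where
  "buffer N Nc u D t \<omega> =
     D + real (N t \<omega>) + stieltjes_integral (\<lambda>\<tau>. u \<tau> \<omega>) (\<lambda>\<tau>. Nc \<tau> \<omega>) t - t"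

definition interruption_event ::
    "'a measure \<Rightarrow> (real \<Rightarrow> 'a \<Rightarrow> nat) \<Rightarrow> (real \<Rightarrow> 'a \<Rightarrow> nat) \<Rightarrow> (real \<Rightarrow> 'a \<Rightarrow> real) \<Rightarrow> real \<Rightarrow> 'a set" where
  "interruption_event M N Nc u D = {\<omega> \<in> space M. \<exists>t\<ge>0. buffer N Nc u D t \<omega> \<le> 0}"

definition interruption_prob ::
    "'a measure \<Rightarrow> (real \<Rightarrow> 'a \<Rightarrow> nat) \<Rightarrow> (real \<Rightarrow> 'a \<Rightarrow> nat) \<Rightarrow> (real \<Rightarrow> 'a \<Rightarrow> real) \<Rightarrow> real \<Rightarrow> real" where
  "interruption_prob M N Nc u D = measure M (interruption_event M N Nc u D)"

text \<open>Measurability is part of feasibility because \<^const>\<open>measure\<close> is \<open>0\<close> on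
  non-measurable sets.\<close>

definition feasible ::
    "'a measure \<Rightarrow> (real \<Rightarrow> 'a \<Rightarrow> nat) \<Rightarrow> (real \<Rightarrow> 'a \<Rightarrow> nat) \<Rightarrow> real \<Rightarrow> real \<Rightarrow> (real \<Rightarrow> 'a \<Rightarrow> real) \<Rightarrow> bool" where
  "feasible M N Nc D \<epsilon> u \<longleftrightarrow>
     interruption_event M N Nc u D \<in> sets M \<and> interruption_prob M N Nc u D \<le> \<epsilon>"

definition rbar :: "real \<Rightarrow> real" where
  "rbar R = Sup {r. r + R * (exp (- r) - 1) = 0}"

definition region :: "real \<Rightarrow> real \<Rightarrow> (real \<times> real) set" where
  "region R0 R1 =
     {(D, \<epsilon>). 0 < \<epsilon> \<and> \<epsilon> < 1 \<and>
        1 / rbar R1 * ln (1 / \<epsilon>) \<le> D \<and> D \<le> 1 / rbar R0 * ln (1 / \<epsilon>)}"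

text \<open>\<open>log (1 / y)\<close> for \<open>y \<ge> 0\<close>, with the convention \<open>log (1 / 0) = \<infinity>\<close>.\<close>

definition log_recip :: "real \<Rightarrow> ereal" where
  "log_recip y = (if y = 0 then \<infinity> else ereal (ln (1 / y)))"

definition switch_time :: "real \<Rightarrow> real \<Rightarrow> real \<Rightarrow> real \<Rightarrow> ereal" where
  "switch_time R0 R1 D \<epsilon> =
     ereal (R0 / (R1 - R0)) *
       (ereal (1 / rbar R0) * log_recip (\<epsilon> - exp (- rbar R1 * D)) - ereal D)"

definition offline_policy :: "ereal \<Rightarrow> real \<Rightarrow> 'a \<Rightarrow> real" where
  "offline_policy ts t \<omega> = (if ereal t \<le> ts then 1 else 0)"

end

theory Submission
  imports Defs
begin

text \<open>Before the switch the buffer agrees with the one of the policy that always uses both servers,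
  after it with the one that restarts at the switching time and uses the free server only. For each
  of the two, the exponential of minus the decay rate times the buffer is a martingale, so a maximal
  inequality bounds the probability of ever reaching \<open>0\<close>: by \<open>exp (- \<alpha>\<^sub>1 D)\<close> in the first case and
  by \<open>exp (- \<alpha>\<^sub>0 (D + (R\<^sub>1 / R\<^sub>0 - 1) t\<^sub>s))\<close> in the second. The switching time \<open>t\<^sub>s\<^sup>*\<close> makes
  these two add up to \<open>\<epsilon>\<close>. Since the buffer drifts down between arrivals, it suffices to observe
  it at the times of dyadic grids, where independence of increments gives the maximal inequality
  for products of independent factors.\<close>

section \<open>A maximal inequality for products of independent factors\<close>

text \<open>Stopping the products when they first reach \<open>1\<close> turns the maximal inequality into Markov's
  inequality for the stopped product.\<close>

primrec stopped_prod :: "(nat \<Rightarrow> real) \<Rightarrow> nat \<Rightarrow> real" where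
  "stopped_prod w 0 = w 0"
| "stopped_prod w (Suc k) =
     (if 1 \<le> stopped_prod w k then stopped_prod w k else stopped_prod w k * w (Suc k))"

lemma stopped_prod_cong:
  "(\<And>i. i \<le> k \<Longrightarrow> v i = w i) \<Longrightarrow> stopped_prod v k = stopped_prod w k"
  by (induction k) auto

lemma stopped_prod_nonneg:
  "(\<And>i. i \<le> k \<Longrightarrow> 0 \<le> w i) \<Longrightarrow> 0 \<le> stopped_prod w k"
  by (induction k) auto

text \<open>The stopped product freezes at the first partial product that is at least
  \<open>1\<close>; until then it agrees with the partial products. So a partial product reaching
  \<open>1\<close> at any index is still visible at the last one.\<close>

lemma stopped_prod_cases:
  "1 \<le> stopped_prod w n \<or>
     (stopped_prod w n = (\<Prod>i\<le>n. w i) \<and> (\<forall>k\<le>n. (\<Prod>i\<le>k. w i) < 1))"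
  by (induction n) (auto simp: le_Suc_eq not_le)

text \<open>Only the coordinates up to \<open>k\<close> enter, so for independent factors the
  stopped product is independent of the next one.\<close>

lemma measurable_stopped_prod:
  "{..k} \<subseteq> I \<Longrightarrow> (\<lambda>w. stopped_prod w k) \<in> borel_measurable (PiM I (\<lambda>_. borel))"
proof (induction k)
  case 0
  then show ?case by (auto intro!: measurable_component_singleton)
next
  case (Suc k)
  have "{..k} \<subseteq> I" "Suc k \<in> I" using Suc.prems by (auto simp: subset_eq)
  then have [measurable]: "(\<lambda>w. stopped_prod w k) \<in> borel_measurable (PiM I (\<lambda>_. borel))"
    "(\<lambda>w. w (Suc k)) \<in> borel_measurable (PiM I (\<lambda>_. borel))"
    by (auto intro!: measurable_component_singleton Suc.IH)
  show ?case by simp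
qed

text \<open>The stopped product is a supermartingale: each further factor is independent of the past
  and has mean at most \<open>1\<close>. The factor with index \<open>0\<close> is exempt from this
  bound, so that it can later carry the whole initial phase; its mean becomes the bound.\<close>

lemma (in prob_space) maximal_inequality_prod:
  fixes W :: "nat \<Rightarrow> 'a \<Rightarrow> real"
  assumes ind: "indep_vars (\<lambda>_. borel) W {..n}"
    and pos: "\<And>i \<omega>. i \<le> n \<Longrightarrow> 0 \<le> W i \<omega>"
    and int: "\<And>i. i \<le> n \<Longrightarrow> integrable M (W i)"
    and le: "\<And>i. 0 < i \<Longrightarrow> i \<le> n \<Longrightarrow> expectation (W i) \<le> 1"
  shows "prob {\<omega> \<in> space M. \<exists>k\<le>n. 1 \<le> (\<Prod>i\<le>k. W i \<omega>)} \<le> expectation (W 0)"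
proof -
  define Z where "Z k \<omega> = stopped_prod (\<lambda>i. W i \<omega>) k" for k \<omega>
  have Z0: "Z 0 = W 0" by (auto simp: Z_def)
  have Z: "integrable M (Z k) \<and> expectation (Z k) \<le> expectation (W 0)" if "k \<le> n" for k
    using that
  proof (induction k)
    case 0
    then show ?case using int by (simp add: Z0)
  next
    case (Suc k)
    \<comment> \<open>\<open>f\<close> extracts the part that is still running; the rest of
      \<open>Z k\<close> is frozen, and only \<open>f (Z k \<omega>)\<close> is multiplied by the
      next factor.\<close>
    define f :: "real \<Rightarrow> real" where "f z = (if 1 \<le> z then 0 else z)" for z
    have [measurable]: "f \<in> borel_measurable borel" unfolding f_def by measurable
    have intZ[measurable]: "integrable M (Z k)" using Suc by simp
    have Z_pos: "0 \<le> Z k \<omega>" for \<omega>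
      unfolding Z_def using pos Suc.prems by (intro stopped_prod_nonneg) auto
    then have f_pos: "0 \<le> f (Z k \<omega>)" for \<omega> by (simp add: f_def)
    have intf: "integrable M (\<lambda>\<omega>. f (Z k \<omega>))"
      by (rule Bochner_Integration.integrable_bound[OF intZ]) (use Z_pos in \<open>auto simp: f_def\<close>)
    have "indep_var borel ((\<lambda>w. f (stopped_prod w k)) \<circ> (\<lambda>\<omega>. restrict (\<lambda>i. W i \<omega>) {..k}))
        borel ((\<lambda>w. w (Suc k)) \<circ> (\<lambda>\<omega>. restrict (\<lambda>i. W i \<omega>) {Suc k}))"
      using Suc.prems
      by (intro indep_var_compose[OF indep_var_restrict[OF ind]]
          measurable_compose[OF measurable_stopped_prod] measurable_component_singleton) auto
    moreover have "(\<lambda>w. f (stopped_prod w k)) \<circ> (\<lambda>\<omega>. restrict (\<lambda>i. W i \<omega>) {..k}) = (\<lambda>\<omega>. f (Z k \<omega>))"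
      by (auto simp: Z_def fun_eq_iff intro!: arg_cong[where f=f] stopped_prod_cong)
    moreover have "(\<lambda>w. w (Suc k)) \<circ> (\<lambda>\<omega>. restrict (\<lambda>i. W i \<omega>) {Suc k}) = W (Suc k)"
      by auto
    ultimately have iv: "indep_var borel (\<lambda>\<omega>. f (Z k \<omega>)) borel (W (Suc k))" by simp
    have intW: "integrable M (W (Suc k))" using int Suc.prems by simp
    note prod_int = indep_var_integrable[OF iv intf intW]
    have split: "Z (Suc k) = (\<lambda>\<omega>. (Z k \<omega> - f (Z k \<omega>)) + f (Z k \<omega>) * W (Suc k) \<omega>)"
      by (auto simp: Z_def f_def fun_eq_iff)
    have "expectation (Z (Suc k)) = expectation (Z k) - expectation (\<lambda>\<omega>. f (Z k \<omega>))
        + expectation (\<lambda>\<omega>. f (Z k \<omega>)) * expectation (W (Suc k))"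
      unfolding split using prod_int intZ intf
      by (simp add: indep_var_lebesgue_integral[OF iv intf intW])
    also have "\<dots> \<le> expectation (Z k)"
      using mult_left_mono[OF le[of "Suc k"], of "expectation (\<lambda>\<omega>. f (Z k \<omega>))"]
        Suc.prems f_pos by (simp add: integral_nonneg)
    also have "\<dots> \<le> expectation (W 0)" using Suc by simp
    finally show ?case unfolding split using prod_int intZ intf by simp
  qed
  have "prob {\<omega> \<in> space M. \<exists>k\<le>n. 1 \<le> (\<Prod>i\<le>k. W i \<omega>)} \<le> prob {\<omega> \<in> space M. 1 \<le> Z n \<omega>}"
  proof (rule finite_measure_mono)
    show "{\<omega> \<in> space M. \<exists>k\<le>n. 1 \<le> (\<Prod>i\<le>k. W i \<omega>)} \<subseteq> {\<omega> \<in> space M. 1 \<le> Z n \<omega>}"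
      using stopped_prod_cases[of "\<lambda>i. W i _" n] by (fastforce simp: Z_def)
    show "{\<omega> \<in> space M. 1 \<le> Z n \<omega>} \<in> events"
      using Z[of n] by (intro borel_measurable_le) auto
  qed
  also have "\<dots> \<le> expectation (Z n) / 1"
  proof (rule integral_Markov_inequality_measure[where A="{}"])
    show "AE \<omega> in M. 0 \<le> Z n \<omega>"
      unfolding Z_def using pos by (intro AE_I2 stopped_prod_nonneg)
  qed (use Z[of n] in auto)
  also have "\<dots> \<le> expectation (W 0)" using Z[of n] by simp
  finally show ?thesis .
qed

section \<open>Exponential moments of Poisson variables and increments\<close>

text \<open>The Poisson weights times \<open>exp (- a * real k)\<close> form an exponential series
  with argument \<open>r * exp (- a)\<close>. Summing it as a nonnegative integral yields
  integrability together with the value.\<close>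

lemma
  assumes r: "0 < r"
  shows integrable_exp_poisson: "integrable (measure_pmf (poisson_pmf r)) (\<lambda>k. exp (- a * real k))"
    and expectation_exp_poisson:
      "measure_pmf.expectation (poisson_pmf r) (\<lambda>k. exp (- a * real k)) = exp (r * (exp (- a) - 1))"
proof -
  let ?b = "r * exp (- a)"
  have eq: "r ^ k / fact k * exp (- r) * exp (- a * real k) = exp (- r) * (?b ^ k /\<^sub>R fact k)" for k
    by (simp add: power_mult_distrib exp_of_nat_mult[symmetric] field_simps)
  have sums: "(\<lambda>k. exp (- r) * (?b ^ k /\<^sub>R fact k)) sums (exp (- r) * exp ?b)"
    by (intro sums_mult exp_converges)
  have "(\<integral>\<^sup>+ k. ennreal (exp (- a * real k)) \<partial>measure_pmf (poisson_pmf r)) =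
      (\<integral>\<^sup>+ k. ennreal (exp (- r) * (?b ^ k /\<^sub>R fact k)) \<partial>count_space UNIV)"
    unfolding nn_integral_measure_pmf
    using r by (intro nn_integral_cong) (simp only: pmf_poisson ennreal_mult''[symmetric] exp_ge_zero eq)
  also have "\<dots> = (\<Sum>k. ennreal (exp (- r) * (?b ^ k /\<^sub>R fact k)))"
    by (simp add: nn_integral_count_space_nat)
  also have "\<dots> = ennreal (exp (- r) * exp ?b)"
    using r sums by (subst suminf_ennreal2) (auto simp: sums_iff)
  also have "exp (- r) * exp ?b = exp (r * (exp (- a) - 1))"
    by (simp add: exp_add[symmetric] algebra_simps)
  finally have nn: "(\<integral>\<^sup>+ k. ennreal (exp (- a * real k)) \<partial>measure_pmf (poisson_pmf r)) =
      ennreal (exp (r * (exp (- a) - 1)))" .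
  show "integrable (measure_pmf (poisson_pmf r)) (\<lambda>k. exp (- a * real k))"
    by (rule integrableI_nn_integral_finite[OF _ _ nn]) auto
  show "measure_pmf.expectation (poisson_pmf r) (\<lambda>k. exp (- a * real k)) = exp (r * (exp (- a) - 1))"
    using integral_eq_nn_integral[of "\<lambda>k. exp (- a * real k)" "measure_pmf (poisson_pmf r)"]
    unfolding nn by simp
qed

context poisson_process
begin

lemma measurable_real_process[measurable]:
  "0 \<le> t \<Longrightarrow> (\<lambda>\<omega>. real (N t \<omega>)) \<in> borel_measurable M"
  by (rule measurable_compose[OF measurable_process]) auto

lemma process_mono: "\<omega> \<in> space M \<Longrightarrow> 0 \<le> s \<Longrightarrow> s \<le> t \<Longrightarrow> N s \<omega> \<le> N t \<omega>"
  using mono_paths by (auto simp: mono_on_def)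

text \<open>Natural numbers at distance less than \<open>1\<close> are equal, so a right-continuous
  path is constant for a short while.\<close>

lemma locally_constant_right:
  assumes "\<omega> \<in> space M" "0 \<le> t"
  shows "\<forall>\<^sub>F s in at_right t. N s \<omega> = N t \<omega>"
proof -
  have "((\<lambda>s. real (N s \<omega>)) \<longlongrightarrow> real (N t \<omega>)) (at_right t)"
    using right_continuous_paths[OF assms] by (simp add: continuous_within)
  then have "\<forall>\<^sub>F s in at_right t. dist (real (N s \<omega>)) (real (N t \<omega>)) < 1"
    by (rule tendstoD) simp
  then show ?thesis
    by eventually_elim (simp add: dist_real_def)
qed

lemma measurable_increment:
  assumes "0 \<le> s" "0 \<le> t"
  shows "(\<lambda>\<omega>. N t \<omega> - N s \<omega>) \<in> M \<rightarrow>\<^sub>M count_space UNIV"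
proof -
  have [measurable]: "N t \<in> M \<rightarrow>\<^sub>M count_space UNIV" "N s \<in> M \<rightarrow>\<^sub>M count_space UNIV"
    using assms by (auto intro: measurable_process)
  show ?thesis by measurable
qed

lemma
  assumes "0 \<le> s" "s \<le> t"
  shows integrable_exp_increment: "integrable M (\<lambda>\<omega>. exp (- a * real (N t \<omega> - N s \<omega>)))"
    and expectation_exp_increment:
      "expectation (\<lambda>\<omega>. exp (- a * real (N t \<omega> - N s \<omega>))) = exp (rate * (t - s) * (exp (- a) - 1))"
proof -
  have meas: "(\<lambda>\<omega>. N t \<omega> - N s \<omega>) \<in> M \<rightarrow>\<^sub>M count_space UNIV"
    using assms by (intro measurable_increment) auto
  have "integrable M (\<lambda>\<omega>. exp (- a * real (N t \<omega> - N s \<omega>))) \<and>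
     expectation (\<lambda>\<omega>. exp (- a * real (N t \<omega> - N s \<omega>))) = exp (rate * (t - s) * (exp (- a) - 1))"
  \<comment> \<open>Empty intervals do occur, as the initial phase \<open>[0, s]\<close> with
    \<open>s = 0\<close>, while \<open>poisson_increments\<close> is about
    \<open>s < t\<close>.\<close>
  proof (cases "s = t")
    case True
    then show ?thesis by (simp add: prob_space)
  next
    case False
    then have "s < t" "0 < rate * (t - s)" using assms rate_pos by auto
    then show ?thesis
      using poisson_increments[OF assms(1) \<open>s < t\<close>] integrable_exp_poisson[of "rate * (t - s)" a]
        expectation_exp_poisson[of "rate * (t - s)" a]
        integrable_distr[OF meas, of "\<lambda>k. exp (- a * real k)"]
        integral_distr[OF meas, of "\<lambda>k. exp (- a * real k)"]
      by simp
  qed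
  then show "integrable M (\<lambda>\<omega>. exp (- a * real (N t \<omega> - N s \<omega>)))"
    "expectation (\<lambda>\<omega>. exp (- a * real (N t \<omega> - N s \<omega>))) = exp (rate * (t - s) * (exp (- a) - 1))"
    by auto
qed

end

section \<open>The decay rate as a positive root\<close>

text \<open>The set in \<open>rbar\<close> also contains \<open>0\<close>, so a positive root has to
  be exhibited. The function \<open>g\<close> has its minimum at \<open>ln R\<close>, where it is
  negative, and is nonnegative at \<open>R\<close>; a root lies in between. The set is closed and
  bounded above, so its supremum is a root too.\<close>

lemma rbar_root:
  assumes "1 < R"
  shows "0 < rbar R" and "rbar R = R * (1 - exp (- rbar R))"
proof -
  define g where "g r = r + R * (exp (- r) - 1)" for r
  let ?S = "{r. g r = 0}"
  have cont: "continuous_on A g" for A unfolding g_def by (intro continuous_intros)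
  have ln: "0 < ln R" "ln R < R - 1"
    using assms ln_eq_minus_one[of R] ln_le_minus_one[of R]
    by (auto simp: less_le)
  have "g (ln R) = ln R + 1 - R" using assms by (simp add: g_def exp_minus right_diff_distrib)
  then have "g (ln R) \<le> 0" using ln by simp
  moreover have "0 \<le> g R" using assms by (simp add: g_def field_simps)
  moreover have "ln R \<le> R" using ln by simp
  ultimately obtain r where r: "ln R \<le> r" "g r = 0"
    using IVT'[of g "ln R" 0 R] cont by auto
  \<comment> \<open>Any root equals \<open>R * (1 - exp (- r))\<close> and is therefore below
    \<open>R\<close>.\<close>
  have bdd: "bdd_above ?S"
    by (rule bdd_aboveI[where M=R]) (use assms in \<open>auto simp: g_def algebra_simps\<close>,
      smt (verit, best) exp_gt_zero mult_pos_pos)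
  have "closed ?S"
    using continuous_closed_preimage[OF cont, of UNIV "{0}"] by (simp add: vimage_def)
  then have "Sup ?S \<in> ?S"
    using r bdd by (intro closed_contains_Sup) auto
  moreover have "r \<le> Sup ?S" using r bdd by (intro cSup_upper) auto
  moreover have "rbar R = Sup ?S" by (simp add: rbar_def g_def)
  ultimately show "0 < rbar R" "rbar R = R * (1 - exp (- rbar R))"
    using r ln by (auto simp: g_def algebra_simps)
qed

section \<open>The costly arrivals counted by the off-line policy\<close>

text \<open>Up to time \<open>t\<close> the policy is the indicator of the times up to
  \<open>m\<close>, so the integral is the Stieltjes measure of \<open>(0, m]\<close>. The real
  \<open>m\<close> stands for the minimum of \<open>t\<close> and \<open>ts\<close>, which leaves
  \<open>ts\<close> free to be infinite.\<close>

lemma stieltjes_integral_offline_policy: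
  fixes g :: "real \<Rightarrow> nat"
  assumes mono: "mono_on {0..} g"
    and right: "\<And>t. 0 \<le> t \<Longrightarrow> continuous (at_right t) (\<lambda>s. real (g s))"
    and "0 \<le> t" "0 \<le> m" and m: "\<And>\<tau>. \<tau> \<le> t \<Longrightarrow> ereal \<tau> \<le> ts \<longleftrightarrow> \<tau> \<le> m" "m \<le> t"
  shows "stieltjes_integral (\<lambda>\<tau>. offline_policy ts \<tau> \<omega>) g t = real (g m) - real (g 0)"
proof -
  let ?F = "\<lambda>s. real (g (max 0 s))"
  have mF: "?F x \<le> ?F y" if "x \<le> y" for x y
    using mono that by (auto simp: mono_on_def)
  have rF: "continuous (at_right a) ?F" for a
  proof (cases "0 \<le> a")
    case True
    have "\<forall>\<^sub>F s in at_right a. ?F s = real (g s)"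
      using True by (auto simp: eventually_at_right_field max_def intro!: exI[of _ "a+1"])
    then show ?thesis
      using right[OF True] True by (auto simp: continuous_within max_def
          intro: filterlim_cong[THEN iffD2, rotated -1])
  next
    case False
    have "\<forall>\<^sub>F s in at_right a. ?F s = real (g 0)"
      using False by (auto simp: eventually_at_right_field max_def intro!: exI[of _ 0])
    then show ?thesis
      using False by (auto simp: continuous_within max_def intro: tendsto_eventually)
  qed
  have "stieltjes_integral (\<lambda>\<tau>. offline_policy ts \<tau> \<omega>) g t =
      (\<integral>\<tau>. indicator {0<..m} \<tau> \<partial>interval_measure ?F)"
    unfolding stieltjes_integral_def set_lebesgue_integral_def offline_policy_def
    by (intro Bochner_Integration.integral_cong) (use m in \<open>auto simp: indicator_def\<close>)
  also have "\<dots> = measure (interval_measure ?F) {0<..m}" by simp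
  also have "\<dots> = ?F m - ?F 0"
    using \<open>0 \<le> m\<close> by (intro measure_interval_measure_Ioc mF rF) auto
  finally show ?thesis using \<open>0 \<le> m\<close> by simp
qed

section \<open>Reduction of continuous time to dyadic grids\<close>

context
  fixes y :: "real \<Rightarrow> real" and s :: real
  assumes drift: "\<And>t. s \<le> t \<Longrightarrow> \<forall>\<^sub>F t' in at_right t. y t' \<le> y t"
begin

text \<open>By \<open>drift\<close>, a nonpositive value persists on a short interval to the right,
  which a fine grid must hit. With \<open>4 ^ n\<close> cells of length \<open>1 / 2 ^ n\<close> the
  grid is finite but reaches \<open>s + 2 ^ n\<close>, so growing \<open>n\<close> both refines it
  and exhausts the half-line.\<close>

lemma nonpos_iff_nonpos_dyadic:
  "(\<exists>t\<ge>s. y t \<le> 0) \<longleftrightarrow> (\<exists>n. \<exists>k\<le>4 ^ n. y (s + real k / 2 ^ n) \<le> 0)"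
proof
  assume "\<exists>t\<ge>s. y t \<le> 0"
  then obtain t where t: "s \<le> t" "y t \<le> 0" by auto
  obtain b where b: "t < b" "\<And>t'. t < t' \<Longrightarrow> t' < b \<Longrightarrow> y t' \<le> y t"
    using drift[OF t(1)] by (auto simp: eventually_at_right_field)
  \<comment> \<open>\<open>2 ^ n0\<close> has to be at least \<open>t - s + 1\<close>, to keep the
    index chosen below within \<open>4 ^ n0\<close>, and to exceed \<open>1 / (b - t)\<close>, to
    make the mesh smaller than \<open>b - t\<close>.\<close>
  obtain n0 :: nat where n0: "t - s + 1 + 1 / (b - t) < real n0"
    using reals_Archimedean2 by blast
  have pow: "real n0 \<le> 2 ^ n0" using of_nat_less_two_power[of n0, where 'a=real] by simp
  have bt: "0 < 1 / (b - t)" using b by simp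
  have n: "t - s + 1 \<le> 2 ^ n0" "1 / (b - t) < 2 ^ n0"
    using n0 pow bt t by linarith+
  \<comment> \<open>The first grid index strictly to the right of \<open>t\<close>, hence the
    \<open>+ 1\<close> after the floor.\<close>
  define k where "k = nat (\<lfloor>(t - s) * 2 ^ n0\<rfloor> + 1)"
  have k: "(t - s) * 2 ^ n0 < real k" "real k \<le> (t - s) * 2 ^ n0 + 1"
    using t by (simp_all add: k_def)
  have "1 \<le> (2::real) ^ n0" by simp
  then have "real k \<le> (t - s + 1) * 2 ^ n0"
    using k(2) unfolding distrib_right by linarith
  also have "\<dots> \<le> 2 ^ n0 * 2 ^ n0" using n by (intro mult_right_mono) auto
  also have "\<dots> = real (4 ^ n0)" by (simp add: power_mult_distrib[symmetric])
  finally have "k \<le> 4 ^ n0" by (simp only: of_nat_le_iff)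
  moreover have "t < s + real k / 2 ^ n0" using k(1) by (simp add: field_simps)
  moreover have "s + real k / 2 ^ n0 < b"
  proof -
    have "real k / 2 ^ n0 \<le> (t - s) + 1 / 2 ^ n0" using k(2) by (simp add: field_simps)
    also have "1 / 2 ^ n0 < b - t" using n(2) b(1) by (simp add: field_simps)
    finally show ?thesis by simp
  qed
  ultimately show "\<exists>n. \<exists>k\<le>4 ^ n. y (s + real k / 2 ^ n) \<le> 0"
    using b(2) t(2) by (meson order_trans)
next
  assume "\<exists>n. \<exists>k\<le>4 ^ n. y (s + real k / 2 ^ n) \<le> 0"
  then obtain n k where "y (s + real k / 2 ^ n) \<le> 0" by blast
  then show "\<exists>t\<ge>s. y t \<le> 0" by (intro exI[of _ "s + real k / 2 ^ n"]) simp
qed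

end

context prob_space
begin

text \<open>An uncountable union over times becomes a countable one; measurability and probability
  bounds both rest on this.\<close>

lemma nonpos_event_eq:
  fixes y :: "real \<Rightarrow> 'a \<Rightarrow> real"
  assumes "\<And>\<omega> t. \<omega> \<in> space M \<Longrightarrow> s \<le> t \<Longrightarrow> \<forall>\<^sub>F t' in at_right t. y t' \<omega> \<le> y t \<omega>"
  shows "{\<omega> \<in> space M. \<exists>t\<ge>s. y t \<omega> \<le> 0} =
    (\<Union>n. {\<omega> \<in> space M. \<exists>k\<le>4 ^ n. y (s + real k / 2 ^ n) \<omega> \<le> 0})"
proof -
  have "(\<exists>t\<ge>s. y t \<omega> \<le> 0) \<longleftrightarrow> (\<exists>n. \<exists>k\<le>4 ^ n. y (s + real k / 2 ^ n) \<omega> \<le> 0)"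
    if "\<omega> \<in> space M" for \<omega>
    using assms[OF that] by (rule nonpos_iff_nonpos_dyadic)
  then have "{\<omega> \<in> space M. \<exists>t\<ge>s. y t \<omega> \<le> 0} =
      {\<omega> \<in> space M. \<exists>n. \<exists>k\<le>4 ^ n. y (s + real k / 2 ^ n) \<omega> \<le> 0}"
    by (intro Collect_cong conj_cong refl)
  also have "\<dots> = (\<Union>n. {\<omega> \<in> space M. \<exists>k\<le>4 ^ n. y (s + real k / 2 ^ n) \<omega> \<le> 0})"
    by auto
  finally show ?thesis .
qed

lemma nonpos_dyadic_measurable:
  fixes y :: "real \<Rightarrow> 'a \<Rightarrow> real"
  assumes "\<And>t. s \<le> t \<Longrightarrow> y t \<in> borel_measurable M"
  shows "{\<omega> \<in> space M. \<exists>k\<le>4 ^ n. y (s + real k / 2 ^ n) \<omega> \<le> 0} \<in> events"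
proof -
  have [measurable]: "y (s + real k / 2 ^ n) \<in> borel_measurable M" for k :: nat
    by (rule assms) simp
  show ?thesis by measurable
qed

lemma nonpos_event_measurable:
  fixes y :: "real \<Rightarrow> 'a \<Rightarrow> real"
  assumes "\<And>\<omega> t. \<omega> \<in> space M \<Longrightarrow> s \<le> t \<Longrightarrow> \<forall>\<^sub>F t' in at_right t. y t' \<omega> \<le> y t \<omega>"
    and "\<And>t. s \<le> t \<Longrightarrow> y t \<in> borel_measurable M"
  shows "{\<omega> \<in> space M. \<exists>t\<ge>s. y t \<omega> \<le> 0} \<in> events"
proof -
  have "{\<omega> \<in> space M. \<exists>t\<ge>s. y t \<omega> \<le> 0} =
      (\<Union>n. {\<omega> \<in> space M. \<exists>k\<le>4 ^ n. y (s + real k / 2 ^ n) \<omega> \<le> 0})"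
    using assms(1) by (rule nonpos_event_eq)
  also have "\<dots> \<in> events"
    using nonpos_dyadic_measurable[of s y] assms(2) by (intro sets.countable_UN) blast
  finally show ?thesis .
qed

text \<open>Doubling the index embeds each dyadic grid in the next, so the grid events increase, and
  continuity from below carries a bound that is uniform in the grid over to all times.\<close>

lemma prob_nonpos_event_le:
  fixes y :: "real \<Rightarrow> 'a \<Rightarrow> real"
  assumes drift: "\<And>\<omega> t. \<omega> \<in> space M \<Longrightarrow> s \<le> t \<Longrightarrow> \<forall>\<^sub>F t' in at_right t. y t' \<omega> \<le> y t \<omega>"
    and meas: "\<And>t. s \<le> t \<Longrightarrow> y t \<in> borel_measurable M"
    and le: "\<And>n h. 0 < h \<Longrightarrow> prob {\<omega> \<in> space M. \<exists>k\<le>n. y (s + real k * h) \<omega> \<le> 0} \<le> p"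
  shows "prob {\<omega> \<in> space M. \<exists>t\<ge>s. y t \<omega> \<le> 0} \<le> p"
proof -
  define F where "F n = {\<omega> \<in> space M. \<exists>k\<le>4 ^ n. y (s + real k / 2 ^ n) \<omega> \<le> 0}" for n :: nat
  have "F n \<subseteq> F (Suc n)" for n
  proof
    fix \<omega> assume "\<omega> \<in> F n"
    then obtain k where k: "\<omega> \<in> space M" "k \<le> 4 ^ n" "y (s + real k / 2 ^ n) \<omega> \<le> 0"
      by (auto simp: F_def)
    then have "2 * k \<le> 4 ^ Suc n" "y (s + real (2 * k) / 2 ^ Suc n) \<omega> \<le> 0" by auto
    then show "\<omega> \<in> F (Suc n)" using k(1) unfolding F_def by blast
  qed
  then have inc: "incseq F" by (rule incseq_SucI)
  have "range F \<subseteq> events" unfolding F_def using nonpos_dyadic_measurable[of s y] meas by blast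
  then have "(\<lambda>n. prob (F n)) \<longlonglongrightarrow> prob (\<Union>n. F n)"
    using inc by (rule finite_Lim_measure_incseq)
  moreover have "prob (F n) \<le> p" for n
    using le[of "1 / 2 ^ n" "4 ^ n"] by (simp add: F_def)
  ultimately have "prob (\<Union>n. F n) \<le> p" by (intro LIMSEQ_le_const2) auto
  moreover have "{\<omega> \<in> space M. \<exists>t\<ge>s. y t \<omega> \<le> 0} = (\<Union>n. F n)"
    unfolding F_def using drift by (rule nonpos_event_eq)
  ultimately show ?thesis by simp
qed

end

section \<open>Joint independence of the increments of both processes\<close>

text \<open>Every set of pairs is a countable union of singletons, which are rectangles. This makes
  the rectangles a generator on which independence of pairs can be tested.\<close>

lemma sigma_sets_rectangles:
  "sigma_sets UNIV {A \<times> B |A B. True} = (UNIV :: ('a :: countable \<times> 'b :: countable) set set)"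
proof -
  have "X \<in> sigma_sets UNIV {A \<times> B |A B. True}" for X :: "('a \<times> 'b) set"
  proof -
    have "(\<Union>x\<in>X. {x}) \<in> sigma_sets UNIV {A \<times> B |A B. True}"
    proof (rule sigma_sets_UNION)
      fix b assume "b \<in> (\<lambda>x. {x}) ` X"
      then obtain u v where "b = {u} \<times> {v}" by auto
      then show "b \<in> sigma_sets UNIV {A \<times> B |A B. True}" by (blast intro: sigma_sets.Basic)
    qed simp
    then show ?thesis by simp
  qed
  then show ?thesis by auto
qed

locale two_servers = free: poisson_process M R0 N + costly: poisson_process M Rc Nc
  for M :: "'a measure" and R0 Rc :: real and N Nc :: "real \<Rightarrow> 'a \<Rightarrow> nat" +
  assumes independent: "independent_processes M N Nc"
begin

text \<open>Increments are measurable functions of the path, so they inherit the independence of the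
  paths.\<close>

lemma indep_increments:
  assumes "0 \<le> s" "0 \<le> t"
  shows "free.indep_var (count_space UNIV) (\<lambda>\<omega>. N t \<omega> - N s \<omega>)
    (count_space UNIV) (\<lambda>\<omega>. Nc t \<omega> - Nc s \<omega>)"
proof -
  let ?P = "PiM {0..} (\<lambda>_::real. count_space (UNIV :: nat set))"
  have diff: "(\<lambda>f. X f - Y f) \<in> ?P \<rightarrow>\<^sub>M count_space UNIV"
    if [measurable]: "X \<in> ?P \<rightarrow>\<^sub>M count_space UNIV" "Y \<in> ?P \<rightarrow>\<^sub>M count_space UNIV"
    for X Y :: "(real \<Rightarrow> nat) \<Rightarrow> nat"
    by measurable
  have "(\<lambda>f. f t - f s) \<in> ?P \<rightarrow>\<^sub>M count_space UNIV"
    using assms by (intro diff measurable_component_singleton) auto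
  from free.indep_var_compose[OF independent[unfolded independent_processes_def] this this]
  show ?thesis using assms by (simp add: comp_def)
qed

text \<open>On rectangles the joint probability factors first between the two processes, then over
  the increments of each; regrouping the factors by index gives the pairs.\<close>

lemma indep_increment_pairs:
  assumes "0 \<le> \<tau> 0" "\<And>i. i < n \<Longrightarrow> \<tau> i \<le> \<tau> (Suc i)" "0 < n"
  shows "free.indep_vars (\<lambda>_. count_space UNIV)
    (\<lambda>i \<omega>. (N (\<tau> (Suc i)) \<omega> - N (\<tau> i) \<omega>, Nc (\<tau> (Suc i)) \<omega> - Nc (\<tau> i) \<omega>)) {..<n}"
    (is "free.indep_vars _ ?Y _")
proof -
  have \<tau>: "0 \<le> \<tau> i" if "i \<le> n" for i
    using that by (induction i) (use assms in \<open>auto intro: order_trans\<close>)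
  let ?X = "\<lambda>i \<omega>. N (\<tau> (Suc i)) \<omega> - N (\<tau> i) \<omega>" and ?Xc = "\<lambda>i \<omega>. Nc (\<tau> (Suc i)) \<omega> - Nc (\<tau> i) \<omega>"
  have X: "?X i \<in> M \<rightarrow>\<^sub>M count_space UNIV" "?Xc i \<in> M \<rightarrow>\<^sub>M count_space UNIV"
    if "i < n" for i
    using that \<tau> by (auto intro!: free.measurable_increment costly.measurable_increment)
  have ne: "{..<n} \<noteq> {}" using assms by auto
  show ?thesis
  proof (rule free.indep_vars_finite[where E="\<lambda>_. {A \<times> B |A B. True}", THEN iffD2], goal_cases)
    case (3 i)
    show ?case by (simp only: sets_count_space space_count_space sigma_sets_rectangles Pow_UNIV)
  next
    case (4 i)
    then have "?X i \<in> M \<rightarrow>\<^sub>M count_space UNIV" "?Xc i \<in> M \<rightarrow>\<^sub>M count_space UNIV"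
      using X by auto
    then have "?Y i \<in> M \<rightarrow>\<^sub>M count_space UNIV \<Otimes>\<^sub>M count_space UNIV" by (rule measurable_Pair)
    then show ?case by (simp add: pair_measure_countable)
  next
    case (5 i)
    show ?case unfolding Int_stable_def by (auto simp: Times_Int_Times) blast
  next
    case (6 i)
    show ?case by simp (metis UNIV_Times_UNIV)
  next
    case 8
    show ?case
    proof
      fix A assume A: "A \<in> {..<n} \<rightarrow> {A \<times> B |(A :: nat set) (B :: nat set). True}"
      have "\<exists>F G. A i = F \<times> G" if "i < n" for i
      proof -
        have "A i \<in> {A \<times> B |A B. True}" using A that by (simp only: Pi_iff lessThan_iff)
        then show ?thesis by blast
      qed
      then obtain F G where AFG: "\<And>i. i < n \<Longrightarrow> A i = F i \<times> G i" by metis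
      let ?P = "PiM {0..} (\<lambda>_::real. count_space (UNIV :: nat set))"
      \<comment> \<open>\<open>S H\<close> collects the paths whose increments lie in the sets
        \<open>H i\<close>. Being measurable in path space, such sets turn the joint event into a
        rectangle of path events, to which \<open>independent\<close> applies.\<close>
      define S where "S H = {f \<in> space ?P. \<forall>i<n. f (\<tau> (Suc i)) - f (\<tau> i) \<in> H i}" for H :: "nat \<Rightarrow> nat set"
      have S: "S H \<in> sets ?P" for H
      proof -
        have "{f \<in> space ?P. f (\<tau> (Suc i)) - f (\<tau> i) \<in> H i} \<in> sets ?P" if "i < n" for i
        proof -
          have [measurable]: "(\<lambda>f. f (\<tau> i)) \<in> ?P \<rightarrow>\<^sub>M count_space UNIV"
            "(\<lambda>f. f (\<tau> (Suc i))) \<in> ?P \<rightarrow>\<^sub>M count_space UNIV"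
            using that \<tau>[of i] \<tau>[of "Suc i"] by (auto intro!: measurable_component_singleton)
          show ?thesis by measurable
        qed
        moreover have "S H = (\<Inter>i\<in>{..<n}. {f \<in> space ?P. f (\<tau> (Suc i)) - f (\<tau> i) \<in> H i})"
          using ne by (auto simp: S_def)
        ultimately show ?thesis using ne by auto
      qed
      have pre: "(\<lambda>\<omega>. \<lambda>t\<in>{0..}. Z t \<omega>) -` S H \<inter> space M =
          (\<Inter>i\<in>{..<n}. (\<lambda>\<omega>. Z (\<tau> (Suc i)) \<omega> - Z (\<tau> i) \<omega>) -` H i \<inter> space M)" for Z H
        using ne \<tau> by (auto simp: S_def space_PiM)
      have "free.prob (\<Inter>j\<in>{..<n}. ?Y j -` A j \<inter> space M) =
          free.prob ((\<lambda>\<omega>. (\<lambda>t\<in>{0..}. N t \<omega>, \<lambda>t\<in>{0..}. Nc t \<omega>)) -` (S F \<times> S G) \<inter> space M)"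
      proof (rule arg_cong[where f=free.prob])
        have "(\<lambda>\<omega>. (\<lambda>t\<in>{0..}. N t \<omega>, \<lambda>t\<in>{0..}. Nc t \<omega>)) -` (S F \<times> S G) \<inter> space M =
            ((\<lambda>\<omega>. \<lambda>t\<in>{0..}. N t \<omega>) -` S F \<inter> space M) \<inter> ((\<lambda>\<omega>. \<lambda>t\<in>{0..}. Nc t \<omega>) -` S G \<inter> space M)"
          by auto
        also have "\<dots> = (\<Inter>j\<in>{..<n}. ?Y j -` A j \<inter> space M)"
          unfolding pre using ne by (auto simp: AFG)
        finally show "(\<Inter>j\<in>{..<n}. ?Y j -` A j \<inter> space M) =
          (\<lambda>\<omega>. (\<lambda>t\<in>{0..}. N t \<omega>, \<lambda>t\<in>{0..}. Nc t \<omega>)) -` (S F \<times> S G) \<inter> space M" by simp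
      qed
      also have "\<dots> = free.prob ((\<lambda>\<omega>. \<lambda>t\<in>{0..}. N t \<omega>) -` S F \<inter> space M) *
          free.prob ((\<lambda>\<omega>. \<lambda>t\<in>{0..}. Nc t \<omega>) -` S G \<inter> space M)"
        by (intro free.indep_varD[OF independent[unfolded independent_processes_def]] S)
      also have "free.prob ((\<lambda>\<omega>. \<lambda>t\<in>{0..}. N t \<omega>) -` S F \<inter> space M) =
          (\<Prod>j<n. free.prob (?X j -` F j \<inter> space M))"
        unfolding pre using ne
        by (intro free.indep_varsD_finite[OF free.independent_increments[of \<tau> n]]) (use assms in auto)
      also have "free.prob ((\<lambda>\<omega>. \<lambda>t\<in>{0..}. Nc t \<omega>) -` S G \<inter> space M) =
          (\<Prod>j<n. free.prob (?Xc j -` G j \<inter> space M))"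
        unfolding pre using ne
        by (intro free.indep_varsD_finite[OF costly.independent_increments[of \<tau> n]]) (use assms in auto)
      \<comment> \<open>The factors are paired by index; for the same interval
        \<open>indep_increments\<close> merges the two probabilities again.\<close>
      also have "(\<Prod>j<n. free.prob (?X j -` F j \<inter> space M)) * (\<Prod>j<n. free.prob (?Xc j -` G j \<inter> space M)) =
          (\<Prod>j<n. free.prob (?Y j -` A j \<inter> space M))"
        unfolding prod.distrib[symmetric]
      proof (rule prod.cong)
        fix i assume "i \<in> {..<n}"
        then have i: "i < n" by simp
        show "free.prob (?X i -` F i \<inter> space M) * free.prob (?Xc i -` G i \<inter> space M) =
            free.prob (?Y i -` A i \<inter> space M)"
          using \<tau>[of i] \<tau>[of "Suc i"] i
          by (subst free.indep_varD[OF indep_increments, symmetric])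
             (auto simp: AFG intro!: arg_cong[where f=free.prob])
      qed simp
      finally show "free.prob (\<Inter>j\<in>{..<n}. ?Y j -` A j \<inter> space M) =
          (\<Prod>j\<in>{..<n}. free.prob (?Y j -` A j \<inter> space M))" .
    qed
  qed (use ne in auto)
qed

section \<open>Exponential bounds for the buffer\<close>

text \<open>The partial products of the \<open>W i\<close> are the exponentials of
  \<open>- a\<close> times the buffer at grid times, so a nonpositive buffer means a product of at
  least \<open>1\<close>. By \<open>root\<close> all factors after the initial one have mean
  \<open>1\<close>, and the mean of the initial one is the bound.\<close>

lemma buffer_grid_bound:
  fixes D :: real
  assumes a: "0 < a" and root: "a = R0 * (1 - exp (- a)) + Rc * (1 - exp (- a * real c))"
    and s: "0 \<le> s" and h: "0 < h"
  defines "y \<equiv> \<lambda>t \<omega>. D + real (N t \<omega>) + real (Nc s \<omega>) + real c * (real (Nc t \<omega>) - real (Nc s \<omega>)) - t"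
  shows "free.prob {\<omega> \<in> space M. \<exists>k\<le>n. y (s + real k * h) \<omega> \<le> 0} \<le>
    exp (- a * (D - s) - (R0 + Rc) * s * (1 - exp (- a)))"
proof -
  \<comment> \<open>the first increment covers \<open>[0, s]\<close>, the later ones the cells of the grid\<close>
  define \<tau> where "\<tau> i = (if i = 0 then 0 else s + real (i - 1) * h)" for i :: nat
  have \<tau>_simps: "\<tau> 0 = 0" "\<tau> (Suc i) = s + real i * h" for i by (simp_all add: \<tau>_def)
  have \<tau>_nonneg: "0 \<le> \<tau> i" for i using s h by (simp add: \<tau>_def)
  have \<tau>_mono: "\<tau> i \<le> \<tau> (Suc i)" for i using s h by (cases i) (auto simp: \<tau>_simps algebra_simps)
  define X where "X i \<omega> = N (\<tau> (Suc i)) \<omega> - N (\<tau> i) \<omega>" for i \<omega>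
  define Xc where "Xc i \<omega> = Nc (\<tau> (Suc i)) \<omega> - Nc (\<tau> i) \<omega>" for i \<omega>
  \<comment> \<open>\<open>m\<close> weighs the costly arrivals: before \<open>s\<close> both
    servers work, whatever \<open>c\<close> is. \<open>d\<close> is the deterministic part of the
    increment, with the initial buffer put into the first one.\<close>
  define m where "m i = (if i = 0 then 1 else c)" for i :: nat
  define d where "d i = (if i = 0 then D - s else - h)" for i :: nat
  define W where "W i \<omega> = exp (- a * (d i + real (X i \<omega>) + real (m i) * real (Xc i \<omega>)))" for i \<omega>
  have "free.indep_vars (\<lambda>_. count_space UNIV) (\<lambda>i \<omega>. (X i \<omega>, Xc i \<omega>)) {..<Suc n}"
    unfolding X_def Xc_def by (rule indep_increment_pairs) (use \<tau>_mono \<tau>_nonneg in auto)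
  from free.indep_vars_compose2[OF this,
      of "\<lambda>i (x, z). exp (- a * (d i + real x + real (m i) * real z))" "\<lambda>_. borel"]
  have ind: "free.indep_vars (\<lambda>_. borel) W {..n}"
    by (simp add: W_def[abs_def] lessThan_Suc_atMost)
  have W_int: "integrable M (W i)" and W_exp: "free.expectation (W i) =
      exp (- a * d i) * exp (R0 * (\<tau> (Suc i) - \<tau> i) * (exp (- a) - 1)) *
      exp (Rc * (\<tau> (Suc i) - \<tau> i) * (exp (- a * real (m i)) - 1))" for i
  proof -
    have W_eq: "W i = (\<lambda>\<omega>. exp (- a * d i) * (exp (- a * real (X i \<omega>)) * exp (- (a * real (m i)) * real (Xc i \<omega>))))"
      by (simp add: W_def fun_eq_iff exp_add[symmetric] algebra_simps)
    have iv: "free.indep_var borel (\<lambda>\<omega>. exp (- a * real (X i \<omega>)))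
        borel (\<lambda>\<omega>. exp (- (a * real (m i)) * real (Xc i \<omega>)))"
      using free.indep_var_compose[OF indep_increments[OF \<tau>_nonneg[of i] \<tau>_nonneg[of "Suc i"]],
          of "\<lambda>x. exp (- a * real x)" borel "\<lambda>z. exp (- (a * real (m i)) * real z)" borel]
      by (simp add: comp_def X_def Xc_def)
    note iX = free.integrable_exp_increment[OF \<tau>_nonneg \<tau>_mono, of a i, folded X_def]
    note iXc = costly.integrable_exp_increment[OF \<tau>_nonneg \<tau>_mono, of "a * real (m i)" i, folded Xc_def]
    show "integrable M (W i)"
      unfolding W_eq by (intro integrable_mult_right free.indep_var_integrable[OF iv iX iXc])
    show "free.expectation (W i) =
      exp (- a * d i) * exp (R0 * (\<tau> (Suc i) - \<tau> i) * (exp (- a) - 1)) *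
      exp (Rc * (\<tau> (Suc i) - \<tau> i) * (exp (- a * real (m i)) - 1))"
      unfolding W_eq integral_mult_right_zero free.indep_var_lebesgue_integral[OF iv iX iXc]
      using free.expectation_exp_increment[OF \<tau>_nonneg \<tau>_mono, of a i]
        costly.expectation_exp_increment[OF \<tau>_nonneg \<tau>_mono, of "a * real (m i)" i]
      by (simp add: X_def Xc_def)
  qed
  have W1: "free.expectation (W i) = 1" if "0 < i" for i
  proof -
    from that obtain j where i: "i = Suc j" by (cases i) auto
    \<comment> \<open>This is \<open>root\<close> times \<open>- h\<close>: the Poisson exponents
      cancel the \<open>a * h\<close> that comes from the consumption during one cell.\<close>
    have "R0 * h * (exp (- a) - 1) + Rc * h * (exp (- a * real c) - 1) = - (a * h)"
      by (subst (3) root) (simp add: algebra_simps)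
    then show ?thesis
      unfolding W_exp i by (simp add: \<tau>_simps d_def m_def exp_add[symmetric] algebra_simps)
  qed
  have W0: "free.expectation (W 0) = exp (- a * (D - s) - (R0 + Rc) * s * (1 - exp (- a)))"
    unfolding W_exp by (simp add: \<tau>_simps d_def m_def exp_add[symmetric] algebra_simps)
  \<comment> \<open>The product telescopes, starting from the buffer at time \<open>s\<close>
    because both processes start at \<open>0\<close>.\<close>
  have prod: "(\<Prod>i\<le>k. W i \<omega>) = exp (- a * y (s + real k * h) \<omega>)" if \<omega>: "\<omega> \<in> space M" for k \<omega>
  proof (induction k)
    case 0
    then show ?case
      using free.starts_at_zero[OF \<omega>] costly.starts_at_zero[OF \<omega>]
      by (simp add: W_def X_def Xc_def d_def m_def y_def \<tau>_simps algebra_simps)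
  next
    case (Suc k)
    \<comment> \<open>Monotone paths make the subtraction of natural numbers exact.\<close>
    have "real (X (Suc k) \<omega>) = real (N (s + real (Suc k) * h) \<omega>) - real (N (s + real k * h) \<omega>)"
      using free.process_mono[OF \<omega> \<tau>_nonneg \<tau>_mono, of "Suc k"] by (simp add: X_def \<tau>_simps of_nat_diff)
    moreover have "real (Xc (Suc k) \<omega>) = real (Nc (s + real (Suc k) * h) \<omega>) - real (Nc (s + real k * h) \<omega>)"
      using costly.process_mono[OF \<omega> \<tau>_nonneg \<tau>_mono, of "Suc k"] by (simp add: Xc_def \<tau>_simps of_nat_diff)
    ultimately have "W (Suc k) \<omega> = exp (- a * (y (s + real (Suc k) * h) \<omega> - y (s + real k * h) \<omega>))"
      by (simp only: W_def) (simp add: d_def m_def y_def algebra_simps)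
    then show ?case
      unfolding prod.atMost_Suc Suc.IH by (simp add: exp_add[symmetric] right_diff_distrib)
  qed
  have "{\<omega> \<in> space M. \<exists>k\<le>n. y (s + real k * h) \<omega> \<le> 0} = {\<omega> \<in> space M. \<exists>k\<le>n. 1 \<le> (\<Prod>i\<le>k. W i \<omega>)}"
    using a by (auto simp: prod mult_le_0_iff)
  also have "free.prob \<dots> \<le> free.expectation (W 0)"
  proof (rule free.maximal_inequality_prod[OF ind])
    show "0 \<le> W i \<omega>" for i \<omega> by (simp add: W_def)
  qed (simp_all add: W_int W1)
  finally show ?thesis by (simp only: W0)
qed

text \<open>For \<open>c = 1\<close> both servers are used forever; for \<open>c = 0\<close> the costly one is switched off at
  time \<open>s\<close>.\<close>

lemma buffer_bound:
  fixes D :: real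
  assumes a: "0 < a" and root: "a = R0 * (1 - exp (- a)) + Rc * (1 - exp (- a * real c))"
    and s: "0 \<le> s"
  defines "y \<equiv> \<lambda>t \<omega>. D + real (N t \<omega>) + real (Nc s \<omega>) + real c * (real (Nc t \<omega>) - real (Nc s \<omega>)) - t"
  shows "{\<omega> \<in> space M. \<exists>t\<ge>s. y t \<omega> \<le> 0} \<in> free.events"
    and "free.prob {\<omega> \<in> space M. \<exists>t\<ge>s. y t \<omega> \<le> 0} \<le>
      exp (- a * (D - s) - (R0 + Rc) * s * (1 - exp (- a)))"
proof -
  \<comment> \<open>Just after \<open>t\<close> both counts are unchanged and only the term
    \<open>- t\<close> moves, downwards.\<close>
  have drift: "\<forall>\<^sub>F t' in at_right t. y t' \<omega> \<le> y t \<omega>" if "\<omega> \<in> space M" "s \<le> t" for \<omega> t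
  proof -
    have "0 \<le> t" using s that by simp
    with that have "\<forall>\<^sub>F t' in at_right t. N t' \<omega> = N t \<omega>" "\<forall>\<^sub>F t' in at_right t. Nc t' \<omega> = Nc t \<omega>"
      using free.locally_constant_right costly.locally_constant_right by auto
    with eventually_at_right_less[of t] show ?thesis
      by eventually_elim (simp add: y_def)
  qed
  have meas: "y t \<in> borel_measurable M" if "s \<le> t" for t
  proof -
    have [measurable]: "(\<lambda>\<omega>. real (N t \<omega>)) \<in> borel_measurable M"
      "(\<lambda>\<omega>. real (Nc t \<omega>)) \<in> borel_measurable M" "(\<lambda>\<omega>. real (Nc s \<omega>)) \<in> borel_measurable M"
      using s that by (auto intro: free.measurable_real_process costly.measurable_real_process)
    show ?thesis unfolding y_def by measurable
  qed
  show "{\<omega> \<in> space M. \<exists>t\<ge>s. y t \<omega> \<le> 0} \<in> free.events"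
    using drift meas by (rule free.nonpos_event_measurable)
  show "free.prob {\<omega> \<in> space M. \<exists>t\<ge>s. y t \<omega> \<le> 0} \<le>
      exp (- a * (D - s) - (R0 + Rc) * s * (1 - exp (- a)))"
    using drift meas
  proof (rule free.prob_nonpos_event_le)
    fix n and h :: real assume "0 < h"
    then show "free.prob {\<omega> \<in> space M. \<exists>k\<le>n. y (s + real k * h) \<omega> \<le> 0} \<le>
        exp (- a * (D - s) - (R0 + Rc) * s * (1 - exp (- a)))"
      unfolding y_def by (rule buffer_grid_bound[OF a root s])
  qed
qed

section \<open>Interruption under the off-line policy\<close>

text \<open>The minimum with a real time is real even for infinite \<open>ts\<close>; it is the
  \<open>m\<close> of \<open>stieltjes_integral_offline_policy\<close>, at which the count of costly
  arrivals stops.\<close>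

lemma buffer_offline_policy:
  assumes \<omega>: "\<omega> \<in> space M" and "0 \<le> t" and "0 \<le> ts"
  shows "buffer N Nc (offline_policy ts) D t \<omega> =
    D + real (N t \<omega>) + real (Nc (real_of_ereal (min (ereal t) ts)) \<omega>) - t"
proof -
  define m where "m = real_of_ereal (min (ereal t) ts)"
  have m: "ereal m = min (ereal t) ts"
    using assms by (cases ts) (auto simp: m_def min_def)
  have "ereal 0 \<le> ereal m" "ereal m \<le> ereal t" unfolding m using assms by (simp_all add: zero_ereal_def[symmetric])
  then have "0 \<le> m" "m \<le> t" by simp_all
  moreover have "ereal \<tau> \<le> ts \<longleftrightarrow> \<tau> \<le> m" if "\<tau> \<le> t" for \<tau>
  proof -
    have "\<tau> \<le> m \<longleftrightarrow> ereal \<tau> \<le> min (ereal t) ts" unfolding m[symmetric] by simp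
    then show ?thesis using that by simp
  qed
  ultimately have "stieltjes_integral (\<lambda>\<tau>. offline_policy ts \<tau> \<omega>) (\<lambda>\<tau>. Nc \<tau> \<omega>) t =
      real (Nc m \<omega>) - real (Nc 0 \<omega>)"
    using costly.mono_paths[OF \<omega>] costly.right_continuous_paths[OF \<omega>] \<open>0 \<le> t\<close>
    by (intro stieltjes_integral_offline_policy)
  then show ?thesis
    using costly.starts_at_zero[OF \<omega>] by (simp add: buffer_def m_def)
qed

text \<open>The measurability half of \<open>feasible\<close>, obtained from the dyadic reduction
  for the switched buffer itself.\<close>

lemma interruption_event_measurable:
  assumes "0 \<le> ts"
  shows "interruption_event M N Nc (offline_policy ts) D \<in> free.events"
proof -
  let ?m = "\<lambda>t. real_of_ereal (min (ereal t) ts)"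
  define y where "y t \<omega> = D + real (N t \<omega>) + real (Nc (?m t) \<omega>) - t" for t \<omega>
  have m_nonneg: "0 \<le> ?m t" if "0 \<le> t" for t using assms that by (simp add: real_of_ereal_pos)
  have "\<forall>\<^sub>F t' in at_right t. y t' \<omega> \<le> y t \<omega>" if \<omega>: "\<omega> \<in> space M" "0 \<le> t" for \<omega> t
  proof -
    have "\<forall>\<^sub>F t' in at_right t. Nc (?m t') \<omega> = Nc (?m t) \<omega>"
    \<comment> \<open>Before the switch the time at which costly arrivals are counted moves with
      \<open>t\<close>, and \<open>u\<close> leaves room to the right of \<open>t\<close>; from the
      switch on that time is fixed.\<close>
    proof (cases "ereal t < ts")
      case True
      then obtain u where u: "t < u" "ereal u \<le> ts"
        using ereal_dense2[OF True] by (auto intro: less_imp_le)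
      then have "\<forall>\<^sub>F t' in at_right t. t' < u" by (auto simp: eventually_at_right_field)
      with costly.locally_constant_right[OF \<omega>(1,2)] show ?thesis
      proof eventually_elim
        case (elim t')
        have "ereal t' \<le> ereal u" using elim by simp
        then have "ereal t' \<le> ts" using u(2) by (rule order_trans)
        then have "?m t' = t'" "?m t = t" using True by (simp_all add: min_absorb1 less_imp_le)
        then show ?case using elim by simp
      qed
    next
      case False
      have "\<forall>\<^sub>F t' in at_right t. ?m t' = ?m t"
        using eventually_at_right_less[of t]
      proof eventually_elim
        case (elim t')
        have "ts \<le> ereal t" using False by simp
        moreover have "ereal t \<le> ereal t'" using elim by simp
        ultimately have "ts \<le> ereal t'" by (rule order_trans)
        with \<open>ts \<le> ereal t\<close> show ?case by (simp add: min_absorb2)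
      qed
      then show ?thesis by eventually_elim simp
    qed
    with free.locally_constant_right[OF \<omega>(1,2)] eventually_at_right_less[of t] show ?thesis
      by eventually_elim (simp add: y_def)
  qed
  moreover have "y t \<in> borel_measurable M" if "0 \<le> t" for t
  proof -
    have [measurable]: "(\<lambda>\<omega>. real (N t \<omega>)) \<in> borel_measurable M"
      "(\<lambda>\<omega>. real (Nc (?m t) \<omega>)) \<in> borel_measurable M"
      using m_nonneg that by (auto intro: free.measurable_real_process costly.measurable_real_process)
    show ?thesis unfolding y_def by measurable
  qed
  ultimately have "{\<omega> \<in> space M. \<exists>t\<ge>0. y t \<omega> \<le> 0} \<in> free.events"
    by (rule free.nonpos_event_measurable)
  also have "{\<omega> \<in> space M. \<exists>t\<ge>0. y t \<omega> \<le> 0} = interruption_event M N Nc (offline_policy ts) D"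
    unfolding interruption_event_def y_def using buffer_offline_policy assms by auto
  finally show ?thesis .
qed

text \<open>The case \<open>c = 1\<close>, \<open>s = 0\<close> of \<open>buffer_bound\<close>,
  where the root equation is the one for the total rate.\<close>

lemma prob_both_servers_le:
  fixes D :: real
  assumes "1 < R0 + Rc"
  defines "E \<equiv> {\<omega> \<in> space M. \<exists>t\<ge>0. D + real (N t \<omega>) + real (Nc t \<omega>) - t \<le> 0}"
  shows "E \<in> free.events" "free.prob E \<le> exp (- rbar (R0 + Rc) * D)"
proof -
  let ?a = "rbar (R0 + Rc)"
  have "?a = R0 * (1 - exp (- ?a)) + Rc * (1 - exp (- ?a * real 1))"
    by (subst rbar_root(2)[OF assms(1)]) (simp add: algebra_simps)
  from buffer_bound[OF rbar_root(1)[OF assms(1)] this order_refl, of D]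
  show "E \<in> free.events" "free.prob E \<le> exp (- rbar (R0 + Rc) * D)"
    by (simp_all add: E_def add.assoc)
qed

text \<open>The case \<open>c = 0\<close> of \<open>buffer_bound\<close>, where only the free server
  enters the root equation.\<close>

lemma prob_after_switch_le:
  fixes D :: real
  assumes "1 < R0" "0 \<le> s"
  defines "E \<equiv> {\<omega> \<in> space M. \<exists>t\<ge>s. D + real (N t \<omega>) + real (Nc s \<omega>) - t \<le> 0}"
  shows "E \<in> free.events" "free.prob E \<le> exp (- rbar R0 * (D + Rc / R0 * s))"
proof -
  let ?a = "rbar R0"
  note a = rbar_root[OF assms(1)]
  have "?a = R0 * (1 - exp (- ?a)) + Rc * (1 - exp (- ?a * real 0))"
    by (subst a(2)) simp
  note b = buffer_bound[OF a(1) this assms(2), of D]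
  \<comment> \<open>With this form of the root equation the arrivals at rate \<open>R0\<close>
    before \<open>s\<close> offset the consumption \<open>s\<close> in the exponent, and only the
    gain from rate \<open>Rc\<close> remains.\<close>
  have e: "1 - exp (- ?a) = ?a / R0" using a(2) assms(1) by (simp add: field_simps)
  show "E \<in> free.events" using b(1) by (simp add: E_def)
  show "free.prob E \<le> exp (- rbar R0 * (D + Rc / R0 * s))"
    using b(2) assms(1) unfolding e by (simp add: E_def algebra_simps add_divide_distrib)
qed

text \<open>Without a switch there is no second phase, so only the first exponential
  remains.\<close>

lemma interruption_prob_le_both_servers:
  assumes "1 < R0"
  shows "interruption_prob M N Nc (offline_policy \<infinity>) D \<le> exp (- rbar (R0 + Rc) * D)"
proof -
  have "interruption_event M N Nc (offline_policy \<infinity>) D =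
      {\<omega> \<in> space M. \<exists>t\<ge>0. D + real (N t \<omega>) + real (Nc t \<omega>) - t \<le> 0}"
    unfolding interruption_event_def using buffer_offline_policy[of _ _ \<infinity>] by auto
  then show ?thesis
    using prob_both_servers_le(2)[of D] assms costly.rate_pos by (simp add: interruption_prob_def)
qed

text \<open>A union bound: an interruption up to time \<open>s\<close> also occurs when both servers
  are used forever, and a later one is an interruption of the buffer restarted at
  \<open>s\<close>.\<close>

lemma interruption_prob_le:
  assumes "1 < R0" "0 \<le> s"
  shows "interruption_prob M N Nc (offline_policy (ereal s)) D \<le>
    exp (- rbar (R0 + Rc) * D) + exp (- rbar R0 * (D + Rc / R0 * s))"
proof -
  let ?A = "{\<omega> \<in> space M. \<exists>t\<ge>0. D + real (N t \<omega>) + real (Nc t \<omega>) - t \<le> 0}"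
  let ?B = "{\<omega> \<in> space M. \<exists>t\<ge>s. D + real (N t \<omega>) + real (Nc s \<omega>) - t \<le> 0}"
  have R: "1 < R0 + Rc" using assms costly.rate_pos by simp
  have "interruption_event M N Nc (offline_policy (ereal s)) D \<subseteq> ?A \<union> ?B"
  proof
    have min_eq: "real_of_ereal (min (ereal t) (ereal s)) = min t s" for t by (simp add: min_def)
    fix \<omega> assume "\<omega> \<in> interruption_event M N Nc (offline_policy (ereal s)) D"
    then obtain t where "\<omega> \<in> space M" "0 \<le> t" "D + real (N t \<omega>) + real (Nc (min t s) \<omega>) - t \<le> 0"
      using assms(2) min_eq by (auto simp: interruption_event_def buffer_offline_policy)
    then show "\<omega> \<in> ?A \<union> ?B" by (cases "t \<le> s") (auto simp: min_def)
  qed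
  then have "interruption_prob M N Nc (offline_policy (ereal s)) D \<le> free.prob (?A \<union> ?B)"
    unfolding interruption_prob_def
    using prob_both_servers_le(1)[OF R, of D] prob_after_switch_le(1)[OF assms, of D]
    by (intro free.finite_measure_mono) auto
  also have "\<dots> \<le> free.prob ?A + free.prob ?B"
    using prob_both_servers_le(1)[OF R, of D] prob_after_switch_le(1)[OF assms, of D]
    by (rule measure_Un_le)
  also have "\<dots> \<le> exp (- rbar (R0 + Rc) * D) + exp (- rbar R0 * (D + Rc / R0 * s))"
    using prob_both_servers_le(2)[OF R, of D] prob_after_switch_le(2)[OF assms, of D] by simp
  finally show ?thesis .
qed

end

section \<open>Splitting the tolerance between the two phases\<close>

theorem theorem3:
  fixes M :: "'a measure" and N Nc :: "real \<Rightarrow> 'a \<Rightarrow> nat"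
    and R0 Rc R1 D \<epsilon> :: real and ts :: ereal
  assumes "R0 > 1" and "Rc > 0" and "R1 = R0 + Rc"
    and "poisson_process M R0 N" and "poisson_process M Rc Nc"
    and "independent_processes M N Nc"
    and "(D, \<epsilon>) \<in> region R0 R1"
    and "ts \<ge> switch_time R0 R1 D \<epsilon>"
  shows "feasible M N Nc D \<epsilon> (offline_policy ts)"
proof -
  interpret two_servers M R0 Rc N Nc
    using assms(4-6) by (simp add: two_servers_def two_servers_axioms_def)
  define \<alpha>0 \<alpha>1 where "\<alpha>0 = rbar R0" and "\<alpha>1 = rbar R1"
  have \<alpha>: "0 < \<alpha>0" "0 < \<alpha>1" using rbar_root(1) assms(1-3) by (auto simp: \<alpha>0_def \<alpha>1_def)
  \<comment> \<open>The share of \<open>\<epsilon>\<close> that the first phase leaves to the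
    second.\<close>
  define \<delta> where "\<delta> = \<epsilon> - exp (- \<alpha>1 * D)"
  have reg: "0 < \<epsilon>" "\<epsilon> < 1" "ln (1 / \<epsilon>) \<le> \<alpha>1 * D" "\<alpha>0 * D \<le> ln (1 / \<epsilon>)"
    using assms(7) \<alpha> by (auto simp: region_def \<alpha>0_def[symmetric] \<alpha>1_def[symmetric] field_simps)
  \<comment> \<open>The lower bound on \<open>D\<close> in the region makes this share
    nonnegative.\<close>
  have "- \<alpha>1 * D \<le> ln \<epsilon>" using reg by (simp add: ln_div)
  then have "exp (- \<alpha>1 * D) \<le> exp (ln \<epsilon>)" by (simp only: exp_le_cancel_iff)
  then have \<delta>: "0 \<le> \<delta>" "\<delta> < \<epsilon>" using reg by (simp_all add: \<delta>_def)
  have sw: "switch_time R0 R1 D \<epsilon> = ereal (R0 / Rc) * (ereal (1 / \<alpha>0) * log_recip \<delta> - ereal D)"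
    using assms(3) by (simp add: switch_time_def \<alpha>0_def \<alpha>1_def \<delta>_def)
  have "0 \<le> ts \<and> interruption_prob M N Nc (offline_policy ts) D \<le> \<epsilon>"
  proof (cases "ts = \<infinity>")
    case True
    then show ?thesis
      using interruption_prob_le_both_servers[OF assms(1), of D] \<delta>(1) assms(3)
      by (simp add: \<delta>_def \<alpha>1_def)
  next
    case False
    \<comment> \<open>A zero share would make the switching time, and with it \<open>ts\<close>,
      infinite.\<close>
    have "\<delta> \<noteq> 0"
      using False assms(1,2,8) \<alpha> unfolding sw by (auto simp: log_recip_def)
    with \<delta> have \<delta>_pos: "0 < \<delta>" by simp
    let ?s = "R0 / Rc * (1 / \<alpha>0 * ln (1 / \<delta>) - D)"
    have le: "ereal ?s \<le> ts" using assms(8) \<delta>_pos unfolding sw by (simp add: log_recip_def)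
    \<comment> \<open>The upper bound on \<open>D\<close> in the region enters here: it makes the
      switching time nonnegative, hence also \<open>ts\<close>.\<close>
    have "ln (1 / \<epsilon>) \<le> ln (1 / \<delta>)" using \<delta>(2) \<delta>_pos by (simp add: ln_div)
    then have "0 \<le> 1 / \<alpha>0 * ln (1 / \<delta>) - D" using reg(4) \<alpha> by (simp add: field_simps)
    then have "0 \<le> ?s" using assms(1,2) by (intro mult_nonneg_nonneg) auto
    with le False obtain s where s: "ts = ereal s" "?s \<le> s" "0 \<le> s"
      by (cases ts) auto
    \<comment> \<open>Solving \<open>?s \<le> s\<close> for the logarithm: the second exponential is
      at most \<open>\<delta>\<close>.\<close>
    have "ln (1 / \<delta>) \<le> \<alpha>0 * (D + Rc / R0 * s)"
      using s(2) assms(1,2) \<alpha> by (simp add: field_simps)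
    then have "- \<alpha>0 * (D + Rc / R0 * s) \<le> ln \<delta>" using \<delta>_pos by (simp add: ln_div)
    then have "exp (- \<alpha>0 * (D + Rc / R0 * s)) \<le> exp (ln \<delta>)" by (simp only: exp_le_cancel_iff)
    also have "\<dots> = \<delta>" using \<delta>_pos by simp
    finally show ?thesis
      using interruption_prob_le[OF assms(1) s(3), of D] s(1,3) assms(3)
      by (simp add: \<delta>_def \<alpha>0_def \<alpha>1_def)
  qed
  then show ?thesis by (simp add: feasible_def interruption_event_measurable)
qed

end
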